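(* Let $F$ be a rational-infinitely divisible distribution function on $\mathbb{R}$, let $c_d\in[0,1]$ be the weight of the discrete part of $F$ in its Lebesgue decomposition, and let $f_d$ be the characteristic function of the discrete part $F_d$. If $c_d>0$, then $\inf_{t\in\mathbb{R}}|f_d(t)|>0$.
   Context: Distribution functions on $\mathbb{R}$ are (right-continuous) distribution functions of probability laws on $\mathbb{R}$. The characteristic function of a distribution function $H$ is $t\mapsto\int_{\mathbb{R}}e^{itx}\,dH(x)$, $t\in\mathbb{R}$. A distribution function $F$ is called rational-infinitely divisible if there exist infinitely divisible distribution functions $F_1$ and $F_2$ on $\mathbb{R}$ such that $F_1=F*F_2$, where $*$ denotes convolution; the class of all such $F$ is denoted $\boldsymbol{Q}$. By the Lebesgue decomposition, every distribution function can be written as $F(x)=c_dF_d(x)+(1-c_d)F_c(x)$, $x\in\mathbb{R}$, where $c_d\in[0,1]$, $F_d$ is a discrete distribution function (its law is a probability law concentrated on a countable set) and $F_c$ is a continuous distribution function; $c_d$ is uniquely determined by $F$ (it is the total mass of the atoms of $F$), and if $c_d>0$ then $F_d$ is uniquely determined by $F$. *)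

theory Defs
  imports "HOL-Probability.Probability"
begin

definition distribution_function :: "(real \<Rightarrow> real) \<Rightarrow> bool" where
  "distribution_function F \<longleftrightarrow> (\<exists>M. real_distribution M \<and> F = cdf M)"

(* For a distribution function F, the law is interval_measure F, its Lebesgue-Stieltjes measure. *)

lemma distribution_function_law:
  assumes "distribution_function F"
  shows "real_distribution (interval_measure F)" "cdf (interval_measure F) = F"
proof -
  obtain M where M: "real_distribution M" "F = cdf M"
    using assms by (auto simp: distribution_function_def)
  interpret real_distribution M by (fact M(1))
  have "mono F" and "(F \<longlongrightarrow> 0) at_bot" and "(F \<longlongrightarrow> 1) at_top"
    and "\<And>a. continuous (at_right a) F"
    using cdf_nondecreasing cdf_lim_at_bot cdf_lim_at_top_prob cdf_is_right_cont M(2)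
    by (auto simp: mono_def)
  then show "real_distribution (interval_measure F)" "cdf (interval_measure F) = F"
    by (auto intro!: real_distribution_interval_measure cdf_interval_measure dest: monoD)
qed

lemma interval_measure_cdf:
  assumes "real_distribution M"
  shows "interval_measure (cdf M) = M"
proof -
  have "distribution_function (cdf M)"
    using assms by (auto simp: distribution_function_def)
  from distribution_function_law[OF this] show ?thesis
    using assms by (intro cdf_unique) auto
qed

definition df_char :: "(real \<Rightarrow> real) \<Rightarrow> real \<Rightarrow> complex" where
  "df_char F = char (interval_measure F)"

definition df_convolution :: "(real \<Rightarrow> real) \<Rightarrow> (real \<Rightarrow> real) \<Rightarrow> real \<Rightarrow> real" where
  "df_convolution F G = cdf (convolution (interval_measure F) (interval_measure G))"

(* The zeroth convolution power is the distribution function of the point mass at 0. *)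
primrec df_conv_power :: "(real \<Rightarrow> real) \<Rightarrow> nat \<Rightarrow> real \<Rightarrow> real" where
  "df_conv_power F 0 = cdf (return borel 0)"
| "df_conv_power F (Suc n) = df_convolution F (df_conv_power F n)"

definition infinitely_divisible :: "(real \<Rightarrow> real) \<Rightarrow> bool" where
  "infinitely_divisible F \<longleftrightarrow> distribution_function F \<and>
     (\<forall>n\<ge>1. \<exists>G. distribution_function G \<and> F = df_conv_power G n)"

definition rational_infinitely_divisible :: "(real \<Rightarrow> real) \<Rightarrow> bool" where
  "rational_infinitely_divisible F \<longleftrightarrow> distribution_function F \<and>
     (\<exists>F1 F2. infinitely_divisible F1 \<and> infinitely_divisible F2 \<and> F1 = df_convolution F F2)"

definition discrete_df :: "(real \<Rightarrow> real) \<Rightarrow> bool" where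
  "discrete_df F \<longleftrightarrow> distribution_function F \<and>
     (\<exists>A. countable A \<and> measure (interval_measure F) A = 1)"

definition continuous_df :: "(real \<Rightarrow> real) \<Rightarrow> bool" where
  "continuous_df F \<longleftrightarrow> distribution_function F \<and> continuous_on UNIV F"

definition discrete_continuous_decomposition ::
    "(real \<Rightarrow> real) \<Rightarrow> real \<Rightarrow> (real \<Rightarrow> real) \<Rightarrow> (real \<Rightarrow> real) \<Rightarrow> bool" where
  "discrete_continuous_decomposition F c Fd Fc \<longleftrightarrow>
     0 \<le> c \<and> c \<le> 1 \<and> discrete_df Fd \<and> continuous_df Fc \<and>
     (\<forall>x. F x = c * Fd x + (1 - c) * Fc x)"

end

theory Submission
  imports Defs "HOL-Real_Asymp.Real_Asymp"
begin

text \<open>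
  Write \<open>f\<close>, \<open>f\<^sub>d\<close>, \<open>f\<^sub>c\<close> for the characteristic functions of \<open>F\<close> and of its discrete
  and continuous parts, and \<open>f = f\<^sub>1 / f\<^sub>2\<close> with \<open>f\<^sub>1\<close>, \<open>f\<^sub>2\<close> infinitely divisible.

  For infinitely divisible \<open>g\<close>, the exponent \<open>\<psi> = - ln (norm g)\<close> has second differences that are
  bounded uniformly in the base point: \<open>\<bar>\<psi> (t + s) + \<psi> (t - s) - 2 * \<psi> t\<bar> \<le> 2 * \<psi> s\<close>. This
  follows without the Levy-Khinchine formula, from the analogous inequality for the characteristic
  functions of the convolution roots of the symmetrized law
  (\<open>infinitely_divisible_char_quasi_multiplicative\<close>). A difference of two such exponents inherits
  a bound of this kind, so \<open>K s * (norm (f t))\<^sup>2 \<le> norm (f (t + s))\<close> with \<open>K s > 0\<close> not depending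
  on \<open>t\<close> (\<open>rational_infinitely_divisible_char_shift\<close>). Thus \<open>f\<close> is small on a region only if
  it is small, to a degree that depends on the shift, on each translate of that region.

  The inequality descends to \<open>c\<^sub>d * f\<^sub>d\<close> (\<open>discrete_part_char_shift\<close>). The translates of \<open>f\<^sub>d\<close> form
  a totally bounded set for the supremum norm (\<open>char_translates_totally_bounded\<close>; this is Bochner's
  form of almost periodicity), whereas \<open>f\<^sub>c\<close> vanishes in quadratic mean and hence is small at finitely
  many prescribed shifts of a common point (\<open>continuous_law_char_small_at_shifts\<close>). Together these
  produce points at which \<open>f\<close> is as close as desired to \<open>c\<^sub>d * f\<^sub>d t\<close> and, simultaneously,
  its shift by \<open>s\<close> is close to \<open>c\<^sub>d * f\<^sub>d (t + s)\<close>.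

  Finally, total boundedness gives a finite set \<open>S\<close> such that every \<open>t\<close> has some \<open>\<sigma> \<in> S\<close> with
  \<open>f\<^sub>d (t - \<sigma>)\<close> within \<open>1 / 2\<close> of \<open>f\<^sub>d 0 = 1\<close>. Shifting back by \<open>\<sigma>\<close> bounds \<open>norm (f\<^sub>d t)\<close> below by
  \<open>K \<sigma> * c\<^sub>d / 4\<close>, and \<open>\<sigma>\<close> ranges over a finite set only.
\<close>

section \<open>Characteristic functions of convolutions and symmetrizations\<close>

lemma real_distribution_convolution:
  assumes "real_distribution M" "real_distribution N"
  shows "real_distribution (convolution M N)"
proof -
  interpret M: real_distribution M by fact
  interpret N: real_distribution N by fact
  interpret pair_prob_space M N ..
  show ?thesis
    unfolding convolution_def by (intro real_distribution_distr) measurable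
qed

lemma (in real_distribution) integrable_char_kernel: "integrable M (\<lambda>x. iexp (t * x))"
  by (intro integrable_const_bound[of _ 1]) (auto simp del: of_real_mult)

lemma char_convolution:
  assumes "real_distribution M" "real_distribution N"
  shows "char (convolution M N) t = char M t * char N t"
proof -
  interpret M: real_distribution M by fact
  interpret N: real_distribution N by fact
  interpret P: pair_prob_space M N ..
  have [measurable]: "(\<lambda>z. fst z + snd z) \<in> borel_measurable (M \<Otimes>\<^sub>M N)"
    by measurable
  have int: "integrable (M \<Otimes>\<^sub>M N) (\<lambda>(x, y). iexp (t * (x + y)))"
    by (intro P.integrable_const_bound[of _ 1]) (auto simp del: of_real_mult of_real_add)
  have "char (convolution M N) t = (\<integral>z. iexp (t * (fst z + snd z)) \<partial>(M \<Otimes>\<^sub>M N))"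
    unfolding char_def convolution_def case_prod_beta
    by (subst integral_distr) auto
  also have "\<dots> = (\<integral>x. \<integral>y. iexp (t * (x + y)) \<partial>N \<partial>M)"
    using P.integral_fst[OF int] by (simp add: case_prod_unfold)
  also have "\<dots> = (\<integral>x. iexp (t * x) * char N t \<partial>M)"
    by (simp add: char_def distrib_left exp_add flip: integral_mult_right_zero)
  also have "\<dots> = char M t * char N t"
    by (simp add: char_def)
  finally show ?thesis .
qed

lemma df_char_convolution:
  assumes "distribution_function F" "distribution_function G"
  shows "df_char (df_convolution F G) t = df_char F t * df_char G t"
  unfolding df_char_def df_convolution_def
  by (simp add: assms interval_measure_cdf real_distribution_convolution char_convolution
        distribution_function_law(1))

lemma real_distribution_return: "real_distribution (return borel (a::real))"
  by (auto simp: real_distribution_def real_distribution_axioms_def prob_space_return)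

lemma distribution_function_conv_power:
  assumes "distribution_function G"
  shows "distribution_function (df_conv_power G n)"
proof (induction n)
  case 0
  show ?case
    unfolding df_conv_power.simps distribution_function_def
    using real_distribution_return by blast
next
  case (Suc n)
  show ?case
    unfolding df_conv_power.simps df_convolution_def distribution_function_def
    using real_distribution_convolution[OF distribution_function_law(1)[OF assms]
        distribution_function_law(1)[OF Suc]] by blast
qed

lemma df_char_conv_power:
  assumes "distribution_function G"
  shows "df_char (df_conv_power G n) t = df_char G t ^ n"
proof (induction n)
  case 0
  show ?case
    by (simp add: df_char_def interval_measure_cdf real_distribution_return char_def integral_return)
next
  case (Suc n)
  then show ?case
    using df_char_convolution[OF assms distribution_function_conv_power[OF assms]] by simp
qed

text \<open>
  Symmetrizing turns characteristic functions into real and nonnegative ones, for which roots and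
  logarithms need no choice of branch.
\<close>

definition symmetrization :: "real measure \<Rightarrow> real measure" where
  "symmetrization M = convolution M (distr M borel uminus)"

lemma real_distribution_symmetrization:
  assumes "real_distribution M"
  shows "real_distribution (symmetrization M)"
proof -
  interpret real_distribution M by fact
  show ?thesis
    unfolding symmetrization_def
    by (intro real_distribution_convolution assms real_distribution_distr) simp
qed

lemma char_symmetrization:
  assumes "real_distribution M"
  shows "char (symmetrization M) t = complex_of_real ((cmod (char M t))\<^sup>2)"
proof -
  interpret real_distribution M by fact
  have rd: "real_distribution (distr M borel uminus)"
    by (intro real_distribution_distr) simp
  have "char (distr M borel uminus) t = (\<integral>x. cnj (iexp (t * x)) \<partial>M)"
    unfolding char_def by (subst integral_distr) (auto simp: exp_cnj)
  also have "\<dots> = cnj (char M t)"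
    unfolding char_def by simp
  finally show ?thesis
    unfolding symmetrization_def
    by (simp only: char_convolution[OF assms rd] complex_norm_square)
qed

text \<open>
  The second difference of \<open>t \<mapsto> exp (\<i> * t * x)\<close> is \<open>exp (\<i> * t * x)\<close> times
  \<open>2 * (cos (s * x) - 1)\<close>, and the first factor has modulus one; this is why the bound
  does not depend on \<open>t\<close>.
\<close>

lemma char_second_difference:
  assumes "real_distribution M"
  shows "cmod (char M (t + s) + char M (t - s) - 2 * char M t) \<le> 2 * (1 - Re (char M s))"
proof -
  interpret real_distribution M by fact
  note I = integrable_char_kernel
  have k: "iexp ((t + s) * x) + iexp ((t - s) * x) - 2 * iexp (t * x)
      = iexp (t * x) * complex_of_real (2 * (cos (s * x) - 1))" for x
    by (simp add: complex_eq_iff Re_exp Im_exp algebra_simps cos_add cos_diff sin_add sin_diff)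
  have abs_k: "\<bar>2 * (cos (s * x) - 1)\<bar> = 2 * (1 - cos (s * x))" for x
    by (auto simp: abs_real_def not_less intro: antisym)
  have "char M (t + s) + char M (t - s) - 2 * char M t =
     (\<integral>x. iexp ((t + s) * x) + iexp ((t - s) * x) - 2 * iexp (t * x) \<partial>M)"
    unfolding char_def using I[of "t + s"] I[of "t - s"] I[of t] by simp
  also have "cmod \<dots> \<le> (\<integral>x. cmod (iexp ((t + s) * x) + iexp ((t - s) * x) - 2 * iexp (t * x)) \<partial>M)"
    by (rule integral_norm_bound)
  also have "\<dots> = (\<integral>x. 2 * (1 - Re (iexp (s * x))) \<partial>M)"
    unfolding k norm_mult norm_of_real abs_k by (simp add: Re_exp del: of_real_mult)
  also have "\<dots> = 2 * (1 - Re (char M s))"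
    unfolding char_def using I[of s] prob_space by simp
  finally show ?thesis .
qed

section \<open>Infinitely divisible characteristic functions\<close>

lemma tendsto_mult_one_minus_root:
  assumes "h > 0"
  shows "(\<lambda>n. real n * (1 - h powr (1 / real n))) \<longlonglongrightarrow> - ln h"
  using assms by real_asymp

text \<open>
  The symmetrization of an \<open>n\<close>-th convolution root has the squared modulus of the root's
  characteristic function as its own, and this is the positive \<open>n\<close>-th root.
\<close>

lemma infinitely_divisible_root:
  assumes "infinitely_divisible F" "n \<ge> 1"
  obtains M where "real_distribution M"
    "\<And>t. char M t = complex_of_real (((cmod (df_char F t))\<^sup>2) powr (1 / real n))"
proof -
  obtain G where G: "distribution_function G" "F = df_conv_power G n"
    using assms unfolding infinitely_divisible_def by blast
  let ?M = "symmetrization (interval_measure G)"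
  have rd: "real_distribution (interval_measure G)"
    using distribution_function_law(1)[OF G(1)] .
  have root: "(c ^ n) powr (1 / real n) = c" if "c \<ge> 0" for c :: real
  proof (cases "c = 0")
    case False
    then have "(c ^ n) powr (1 / real n) = c powr (real n * (1 / real n))"
      using that by (simp only: powr_powr flip: powr_realpow)
    then show ?thesis
      using that assms(2) by simp
  qed (use assms(2) in auto)
  have "(cmod (df_char F t))\<^sup>2 = ((cmod (df_char G t))\<^sup>2) ^ n" for t
    unfolding G(2) df_char_conv_power[OF G(1)] norm_power by (simp only: mult.commute flip: power_mult)
  then have eq: "(cmod (df_char G t))\<^sup>2 = ((cmod (df_char F t))\<^sup>2) powr (1 / real n)" for t
    by (simp only: root zero_le_power2)
  show ?thesis
    by (rule that[OF real_distribution_symmetrization[OF rd]])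
      (simp only: char_symmetrization[OF rd] eq flip: df_char_def)
qed

text \<open>
  With \<open>h = (norm f)\<^sup>2\<close>, each \<open>h powr (1 / n)\<close> is a characteristic function, so
  \<open>char_second_difference\<close> at \<open>t = s\<close> gives
  \<open>1 - h (2 * s) powr (1 / n) \<le> 4 * (1 - h s powr (1 / n))\<close>. If \<open>h s > 0\<close>, the right-hand side
  tends to \<open>0\<close>, which excludes \<open>h (2 * s) = 0\<close>. Positivity near \<open>0\<close> therefore spreads to the
  whole line by doubling.
\<close>

lemma infinitely_divisible_char_nonzero:
  assumes "infinitely_divisible F"
  shows "df_char F t \<noteq> 0"
proof -
  define h where "h t = (cmod (df_char F t))\<^sup>2" for t
  have dF: "distribution_function F"
    using assms by (simp add: infinitely_divisible_def)
  interpret F: real_distribution "interval_measure F"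
    by (rule distribution_function_law(1)[OF dF])
  have h_nonneg: "h t \<ge> 0" for t
    by (simp add: h_def)
  have double: "h (2 * s) > 0" if s: "h s > 0" for s
  proof -
    have lower: "1 - h (2 * s) powr (1 / real n) \<le> 4 * (1 - h s powr (1 / real n))" if n: "n \<ge> 1" for n
    proof -
      obtain M where M: "real_distribution M" "\<And>t. char M t = complex_of_real (h t powr (1 / real n))"
        using infinitely_divisible_root[OF assms n] unfolding h_def by blast
      have "cmod (char M (s + s) + char M (s - s) - 2 * char M s) \<le> 2 * (1 - Re (char M s))"
        by (rule char_second_difference[OF M(1)])
      then have "\<bar>Re (char M (s + s) + char M (s - s) - 2 * char M s)\<bar> \<le> 2 * (1 - Re (char M s))"
        using abs_Re_le_cmod order_trans by blast
      moreover have "char M 0 = 1"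
        by (rule real_distribution.char_zero[OF M(1)])
      ultimately show ?thesis
        unfolding M(2) by (simp add: M(2)[of 0, symmetric] flip: mult_2)
    qed
    have "(\<lambda>n. 4 * (1 - h s powr (1 / real n))) \<longlonglongrightarrow> 0"
      using s by real_asymp
    then have "\<forall>\<^sub>F n in sequentially. 4 * (1 - h s powr (1 / real n)) < 1"
      by (rule order_tendstoD) simp
    then have "\<forall>\<^sub>F n in sequentially. h (2 * s) powr (1 / real n) > 0"
      using eventually_ge_at_top[of 1]
    proof eventually_elim
      case (elim n)
      then show ?case using lower[of n] by linarith
    qed
    then have "h (2 * s) \<noteq> 0"
      using eventually_happens[of _ sequentially] by fastforce
    then show ?thesis
      using h_nonneg[of "2 * s"] by simp
  qed
  have "isCont h 0"
    unfolding h_def df_char_def by (intro continuous_intros F.isCont_char)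
  moreover have "h 0 = 1"
    by (simp add: h_def df_char_def F.char_zero)
  moreover have "(\<lambda>n. t / 2 ^ n) \<longlonglongrightarrow> 0"
    by real_asymp
  ultimately have "(\<lambda>n. h (t / 2 ^ n)) \<longlonglongrightarrow> 1"
    using isCont_tendsto_compose[of 0 h "\<lambda>n. t / 2 ^ n" sequentially] by simp
  then have "\<forall>\<^sub>F n in sequentially. h (t / 2 ^ n) > 0"
    by (rule order_tendstoD) simp
  then obtain n where n: "h (t / 2 ^ n) > 0"
    by (meson eventually_happens trivial_limit_sequentially)
  have "h (2 ^ m * s) > 0" if "h s > 0" for m s
    by (induction m) (use that double in \<open>auto simp: mult.assoc\<close>)
  from this[OF n, of n] show ?thesis
    by (auto simp: h_def)
qed

text \<open>
  The inequalities \<open>\<bar>\<psi> (t + s) + \<psi> (t - s) - 2 * \<psi> t\<bar> \<le> 2 * \<psi> s\<close> for \<open>\<psi> = - ln (g\<^sup>2)\<close>, in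
  exponentiated form. As \<open>\<psi>\<close> is the limit of \<open>n * (1 - g\<^sup>2 powr (1 / n))\<close>, they are limits of
  \<open>char_second_difference\<close>, applied to the \<open>n\<close>-th roots and multiplied by \<open>n\<close>.
\<close>

lemma infinitely_divisible_char_quasi_multiplicative:
  assumes "infinitely_divisible F"
  defines "g \<equiv> \<lambda>t. cmod (df_char F t)"
  shows "(g t)\<^sup>2 * (g s)\<^sup>2 \<le> g (t + s) * g (t - s)"
    and "(g s)\<^sup>2 * (g (t + s) * g (t - s)) \<le> (g t)\<^sup>2"
proof -
  have g: "g t > 0" for t
    unfolding g_def using infinitely_divisible_char_nonzero[OF assms(1)] by simp
  define \<phi> where "\<phi> n t = real n * (1 - ((g t)\<^sup>2) powr (1 / real n))" for n t
  have lim: "(\<lambda>n. \<phi> n t) \<longlonglongrightarrow> - 2 * ln (g t)" for t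
    using tendsto_mult_one_minus_root[of "(g t)\<^sup>2"] g[of t]
    by (simp add: \<phi>_def ln_realpow)
  have "\<forall>\<^sub>F n in sequentially. \<bar>\<phi> n (t + s) + \<phi> n (t - s) - 2 * \<phi> n t\<bar> \<le> 2 * \<phi> n s"
    using eventually_ge_at_top[of 1]
  proof eventually_elim
    case (elim n)
    obtain M where M: "real_distribution M" "\<And>t. char M t = complex_of_real ((g t)\<^sup>2 powr (1 / real n))"
      using infinitely_divisible_root[OF assms(1) elim] unfolding g_def by blast
    have "cmod (char M (t + s) + char M (t - s) - 2 * char M t) \<le> 2 * (1 - Re (char M s))"
      by (rule char_second_difference[OF M(1)])
    then have "\<bar>Re (char M (t + s) + char M (t - s) - 2 * char M t)\<bar> \<le> 2 * (1 - Re (char M s))"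
      using abs_Re_le_cmod order_trans by blast
    then have "real n * \<bar>Re (char M (t + s) + char M (t - s) - 2 * char M t)\<bar> \<le> real n * (2 * (1 - Re (char M s)))"
      by (rule mult_left_mono) simp
    moreover have "real n * \<bar>Re (char M (t + s) + char M (t - s) - 2 * char M t)\<bar>
        = \<bar>real n * Re (char M (t + s) + char M (t - s) - 2 * char M t)\<bar>"
      by (simp add: abs_mult)
    ultimately show ?case
      unfolding M(2) \<phi>_def by (simp add: algebra_simps abs_if split: if_splits)
  qed
  then have "\<bar>- 2 * ln (g (t + s)) + - 2 * ln (g (t - s)) - 2 * (- 2 * ln (g t))\<bar> \<le> 2 * (- 2 * ln (g s))"
    by (rule tendsto_le[OF trivial_limit_sequentially, rotated 2]) (intro tendsto_intros lim)+
  then have "ln ((g t)\<^sup>2 * (g s)\<^sup>2) \<le> ln (g (t + s) * g (t - s))"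
    "ln ((g s)\<^sup>2 * (g (t + s) * g (t - s))) \<le> ln ((g t)\<^sup>2)"
    using g by (simp_all add: ln_mult ln_realpow less_imp_neq[symmetric] abs_le_iff)
  moreover have "(g t)\<^sup>2 * (g s)\<^sup>2 > 0" "g (t + s) * g (t - s) > 0"
    "(g s)\<^sup>2 * (g (t + s) * g (t - s)) > 0" "(g t)\<^sup>2 > 0"
    by (intro mult_pos_pos zero_less_power g)+
  ultimately show "(g t)\<^sup>2 * (g s)\<^sup>2 \<le> g (t + s) * g (t - s)"
    "(g s)\<^sup>2 * (g (t + s) * g (t - s)) \<le> (g t)\<^sup>2"
    by (simp_all only: ln_le_cancel_iff)
qed

text \<open>
  The lower bound for the numerator and the upper bound for the denominator combine to
  \<open>K s * (norm (f t))\<^sup>2 \<le> norm (f (t + s)) * norm (f (t - s))\<close> with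
  \<open>K s = (norm (f\<^sub>1 s) * norm (f\<^sub>2 s))\<^sup>2\<close>; the factor \<open>norm (f (t - s)) \<le> 1\<close> is dropped.
\<close>

lemma rational_infinitely_divisible_char_shift:
  assumes "rational_infinitely_divisible F"
  obtains K :: "real \<Rightarrow> real" where "\<And>s. K s > 0"
    "\<And>s t. K s * (cmod (df_char F t))\<^sup>2 \<le> cmod (df_char F (t + s))"
proof -
  obtain F1 F2 where F: "distribution_function F" "infinitely_divisible F1" "infinitely_divisible F2"
      "F1 = df_convolution F F2"
    using assms unfolding rational_infinitely_divisible_def by blast
  define f where "f t = cmod (df_char F t)" for t
  define g where "g t = cmod (df_char F1 t)" for t
  define h where "h t = cmod (df_char F2 t)" for t
  have pos: "g t > 0" "h t > 0" for t
    unfolding g_def h_def using F infinitely_divisible_char_nonzero by simp_all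
  have prod: "g t = f t * h t" for t
    unfolding f_def g_def h_def F(4)
    using F by (simp add: df_char_convolution infinitely_divisible_def norm_mult)
  have f1: "f t \<le> 1" "f t \<ge> 0" for t
    unfolding f_def df_char_def
    using real_distribution.cmod_char_le_1[OF distribution_function_law(1)[OF F(1)]] by simp_all
  have main: "(g s * h s)\<^sup>2 * (f t)\<^sup>2 \<le> f (t + s)" for s t
  proof -
    let ?H = "h (t + s) * h (t - s)"
    have H: "?H > 0" using pos by simp
    have "((g s * h s)\<^sup>2 * (f t)\<^sup>2) * ?H = (g s)\<^sup>2 * (f t)\<^sup>2 * ((h s)\<^sup>2 * ?H)"
      by (simp add: power_mult_distrib)
    also have "\<dots> \<le> (g s)\<^sup>2 * (f t)\<^sup>2 * (h t)\<^sup>2"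
      using infinitely_divisible_char_quasi_multiplicative(2)[OF F(3), of s t]
      by (intro mult_left_mono) (auto simp: h_def)
    also have "\<dots> = (g t)\<^sup>2 * (g s)\<^sup>2"
      by (simp add: prod[of t] power_mult_distrib)
    also have "\<dots> \<le> g (t + s) * g (t - s)"
      using infinitely_divisible_char_quasi_multiplicative(1)[OF F(2), of t s] by (simp add: g_def)
    also have "\<dots> = (f (t + s) * f (t - s)) * ?H"
      by (simp add: prod)
    finally have "(g s * h s)\<^sup>2 * (f t)\<^sup>2 \<le> f (t + s) * f (t - s)"
      using H by (simp only: mult_le_cancel_right_pos)
    also have "\<dots> \<le> f (t + s)"
      using f1 by (simp add: mult_left_le)
    finally show ?thesis .
  qed
  show ?thesis
    by (rule that[of "\<lambda>s. (g s * h s)\<^sup>2"]) (use main pos in \<open>auto simp: f_def less_imp_neq[symmetric]\<close>)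
qed

section \<open>Almost periodicity for discrete laws\<close>

text \<open>
  All but a small part of the mass sits on a finite set \<open>B\<close>, and the point
  \<open>(exp (\<i> * t * x))\<^sub>x\<close>, \<open>x \<in> B\<close>, moves in a compact torus. Two parameters \<open>t\<close> that fall into the
  same cell of a fine grid on this torus give translates that are uniformly close, and one
  parameter from each of the finitely many occupied cells makes up \<open>S\<close>.
\<close>

lemma char_translates_totally_bounded:
  assumes "real_distribution M" and "countable A" and "measure M A = 1" and "\<epsilon> > 0"
  obtains S where "finite S"
    "\<And>t. \<exists>\<sigma>\<in>S. \<forall>u. cmod (char M (u + t) - char M (u + \<sigma>)) \<le> \<epsilon>"
proof -
  interpret real_distribution M by fact
  have "A \<noteq> {}" using assms(3) by auto
  define B where "B n = from_nat_into A ` {..<n}" for n :: nat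
  have fin: "finite (B n)" for n by (simp add: B_def)
  have "(\<lambda>n. measure M (B n)) \<longlonglongrightarrow> measure M (\<Union>n. B n)"
    by (rule finite_Lim_measure_incseq) (auto simp: B_def incseq_def finite_imp_closed)
  moreover have "(\<Union>n. B n) = range (from_nat_into A)"
    by (auto simp: B_def)
  then have "(\<Union>n. B n) = A"
    using \<open>A \<noteq> {}\<close> assms(2) by simp
  ultimately have "(\<lambda>n. measure M (B n)) \<longlonglongrightarrow> 1"
    using assms(3) by simp
  then have "\<forall>\<^sub>F n in sequentially. measure M (B n) > 1 - \<epsilon> / 4"
    by (rule order_tendstoD) (use assms in simp)
  then obtain m where m: "measure M (B m) > 1 - \<epsilon> / 4"
    by (meson eventually_happens trivial_limit_sequentially)
  \<comment> \<open>Grid width \<open>1 / N \<le> \<epsilon> / 4\<close>: sine and cosine together cost \<open>\<epsilon> / 2\<close>, and the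
    mass below \<open>\<epsilon> / 4\<close> outside the finite set costs another \<open>\<epsilon> / 2\<close>.\<close>
  define N where "N = nat \<lceil>4 / \<epsilon>\<rceil>"
  have N: "real N \<ge> 4 / \<epsilon>" and N0: "real N > 0"
    unfolding N_def using assms(4) by (simp_all add: of_nat_ceiling)
  define cell where
    "cell t = (\<lambda>x\<in>B m. (\<lfloor>real N * cos (t * x)\<rfloor>, \<lfloor>real N * sin (t * x)\<rfloor>))" for t
  have bd: "\<lfloor>real N * c\<rfloor> \<in> {- int N .. int N}" if "\<bar>c\<bar> \<le> 1" for c
  proof -
    have "real N * c \<le> real N * 1" "real N * (-1) \<le> real N * c"
      using that by (intro mult_left_mono; simp add: abs_le_iff)+
    then show ?thesis by (simp add: le_floor_iff floor_le_iff)
  qed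
  have "range cell \<subseteq> PiE (B m) (\<lambda>_. {- int N .. int N} \<times> {- int N .. int N})"
    unfolding cell_def using bd by (auto simp del: atLeastAtMost_iff)
  then have "finite (range cell)"
    by (rule finite_subset) (intro finite_PiE fin finite_cartesian_product finite_atLeastAtMost_int)
  then obtain S where S: "finite S" "range cell = cell ` S"
    using finite_subset_image[of "range cell" cell UNIV] by blast
  show ?thesis
  proof (rule that[OF S(1)])
    fix t
    obtain \<sigma> where \<sigma>: "\<sigma> \<in> S" "cell t = cell \<sigma>"
      using S(2) by blast
    have close: "cmod (iexp (t * x) - iexp (\<sigma> * x)) \<le> \<epsilon> / 2" if "x \<in> B m" for x
    proof -
      have fl: "\<bar>a - b\<bar> \<le> 1 / real N" if "\<lfloor>real N * a\<rfloor> = \<lfloor>real N * b\<rfloor>" for a b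
      proof -
        have "\<bar>real N * a - real N * b\<bar> \<le> 1"
          using that by linarith
        then have "real N * \<bar>a - b\<bar> \<le> 1"
          by (simp add: abs_mult flip: right_diff_distrib)
        then show ?thesis
          using N0 by (simp add: field_simps)
      qed
      have "cell t x = cell \<sigma> x"
        using \<sigma>(2) by simp
      then have "\<bar>cos (t * x) - cos (\<sigma> * x)\<bar> \<le> 1 / real N" "\<bar>sin (t * x) - sin (\<sigma> * x)\<bar> \<le> 1 / real N"
        using that fl by (auto simp: cell_def)
      moreover have "cmod (iexp (t * x) - iexp (\<sigma> * x)) \<le>
          \<bar>cos (t * x) - cos (\<sigma> * x)\<bar> + \<bar>sin (t * x) - sin (\<sigma> * x)\<bar>"
        using cmod_le[of "iexp (t * x) - iexp (\<sigma> * x)"] by (simp add: Re_exp Im_exp)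
      moreover have "2 / real N \<le> \<epsilon> / 2"
        using N N0 assms(4) by (simp add: field_simps)
      ultimately show ?thesis by linarith
    qed
    have "cmod (char M (u + t) - char M (u + \<sigma>)) \<le> \<epsilon>" for u
    proof -
      have BM: "B m \<in> sets M"
        using fin[of m] by (simp add: finite_imp_closed)
      have int_ind: "integrable M (indicator (- B m) :: real \<Rightarrow> real)"
        using BM by (intro integrable_const_bound[of _ 1]) (auto simp: indicator_def)
      have split: "iexp ((u + t) * x) - iexp ((u + \<sigma>) * x) = iexp (u * x) * (iexp (t * x) - iexp (\<sigma> * x))" for x
        by (simp add: ring_distribs exp_add)
      have bound: "cmod (iexp ((u + t) * x) - iexp ((u + \<sigma>) * x)) \<le> \<epsilon> / 2 + 2 * indicator (- B m) x" for x
      proof (cases "x \<in> B m")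
        case True
        then show ?thesis
          unfolding split norm_mult using close by (simp del: of_real_mult)
      next
        case False
        have "cmod (iexp ((u + t) * x) - iexp ((u + \<sigma>) * x)) \<le> 1 + 1"
          by (rule norm_triangle_le_diff) (simp del: of_real_mult)
        then show ?thesis
          using False assms(4) by simp
      qed
      have "cmod (char M (u + t) - char M (u + \<sigma>)) = cmod (\<integral>x. iexp ((u + t) * x) - iexp ((u + \<sigma>) * x) \<partial>M)"
        unfolding char_def by (subst Bochner_Integration.integral_diff) (rule integrable_char_kernel refl)+
      also have "\<dots> \<le> (\<integral>x. cmod (iexp ((u + t) * x) - iexp ((u + \<sigma>) * x)) \<partial>M)"
        by (rule integral_norm_bound)
      also have "\<dots> \<le> (\<integral>x. \<epsilon> / 2 + 2 * indicator (- B m) x \<partial>M)"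
      proof (rule integral_mono)
        show "integrable M (\<lambda>x. cmod (iexp ((u + t) * x) - iexp ((u + \<sigma>) * x)))"
          by (intro integrable_norm Bochner_Integration.integrable_diff integrable_char_kernel)
        show "integrable M (\<lambda>x. \<epsilon> / 2 + 2 * indicator (- B m) x :: real)"
          using int_ind by simp
      qed (rule bound)
      also have "\<dots> = \<epsilon> / 2 + 2 * measure M (- B m)"
        using BM prob_space int_ind by simp
      also have "measure M (- B m) = 1 - measure M (B m)"
        using prob_compl[OF BM] by (simp add: Compl_eq_Diff_UNIV)
      finally show ?thesis using m by simp
    qed
    then show "\<exists>\<sigma>\<in>S. \<forall>u. cmod (char M (u + t) - char M (u + \<sigma>)) \<le> \<epsilon>"
      using \<sigma>(1) by blast
  qed
qed

section \<open>Vanishing in mean for continuous laws\<close>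

lemma symmetrization_no_atom_at_zero:
  assumes "real_distribution M" and "\<And>x. measure M {x} = 0"
  shows "measure (symmetrization M) {0} = 0"
proof -
  interpret real_distribution M by fact
  interpret P: pair_prob_space M "distr M borel uminus"
    by (simp add: pair_prob_space_def pair_sigma_finite_def prob_space_axioms prob_space_imp_sigma_finite prob_space_distr)
  have "emeasure (symmetrization M) {0} = (\<integral>\<^sup>+x. emeasure (distr M borel uminus) {a. a + x \<in> {0}} \<partial>M)"
    unfolding symmetrization_def
    by (rule convolution_emeasure) (auto intro: finite_measure_distr finite_measure_axioms)
  also have "\<dots> = (\<integral>\<^sup>+x. 0 \<partial>M)"
  proof (rule nn_integral_cong)
    fix x :: real
    have "{a. a + x \<in> {0}} = {- x}" by (auto simp: add_eq_0_iff2)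
    moreover have "uminus -` {- x} \<inter> space M = {x}" by auto
    ultimately show "emeasure (distr M borel uminus) {a. a + x \<in> {0}} = 0"
      using assms(2)[of x] by (simp add: emeasure_distr emeasure_eq_measure)
  qed
  finally show ?thesis by (simp add: measure_def)
qed

text \<open>
  By Fubini, averaging a characteristic function over a random argument amounts to weighting its
  law with the characteristic function of the averaging distribution; a wide Gaussian average damps
  all mass away from \<open>0\<close>.
\<close>

lemma char_average:
  assumes "real_distribution R" and "real_distribution N"
  shows "(\<integral>z. char R (a + c * z) \<partial>N) = (\<integral>x. iexp (a * x) * char N (c * x) \<partial>R)"
proof -
  interpret R: real_distribution R by fact
  interpret N: real_distribution N by fact
  interpret P: pair_prob_space R N ..
  have int: "integrable (R \<Otimes>\<^sub>M N) (\<lambda>(x, z). iexp ((a + c * z) * x))"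
    by (intro P.integrable_const_bound[of _ 1]) (auto simp del: of_real_mult of_real_add)
  have "(\<integral>z. char R (a + c * z) \<partial>N) = (\<integral>x. \<integral>z. iexp ((a + c * z) * x) \<partial>N \<partial>R)"
    unfolding char_def by (rule P.Fubini_integral[OF int])
  also have "\<dots> = (\<integral>x. iexp (a * x) * char N (c * x) \<partial>R)"
    unfolding char_def integral_mult_right_zero[symmetric]
    by (simp add: ring_distribs exp_add mult_ac)
  finally show ?thesis .
qed

text \<open>
  A form of Wiener's lemma: averages over wider and wider Gaussian windows, centred anywhere, only
  retain the contribution of an atom at \<open>0\<close>. The Gaussian window is convenient because its
  characteristic function is explicit and positive.
\<close>

lemma gaussian_average_char_tendsto_0:
  assumes "real_distribution R" and "measure R {0} = 0"
  shows "(\<lambda>n. \<integral>z. char R (a + real n * z) \<partial>std_normal_distribution) \<longlonglongrightarrow> 0"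
proof -
  interpret real_distribution R by fact
  have AE: "AE x in R. x \<noteq> 0"
    using assms(2) by (intro AE_I[of _ _ "{0}"]) (auto simp: emeasure_eq_measure)
  have "(\<lambda>n. \<integral>x. iexp (a * x) * char std_normal_distribution (real n * x) \<partial>R) \<longlonglongrightarrow> (\<integral>x. 0 \<partial>R)"
  proof (rule integral_dominated_convergence[where w = "\<lambda>_. 1"])
    show "AE x in R. (\<lambda>n. iexp (a * x) * char std_normal_distribution (real n * x)) \<longlonglongrightarrow> 0"
      using AE
    proof eventually_elim
      case (elim x)
      then have "x\<^sup>2 > 0" by simp
      have "(\<lambda>n. exp (- ((real n * x)\<^sup>2) / 2)) \<longlonglongrightarrow> 0"
        unfolding power_mult_distrib using \<open>x\<^sup>2 > 0\<close> by real_asymp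
      then have "(\<lambda>n. iexp (a * x) * complex_of_real (exp (- ((real n * x)\<^sup>2) / 2))) \<longlonglongrightarrow>
          iexp (a * x) * complex_of_real 0"
        by (intro tendsto_intros)
      then show ?case by (simp add: char_std_normal_distribution)
    qed
    show "AE x in R. norm (iexp (a * x) * char std_normal_distribution (real n * x)) \<le> 1" for n
      unfolding norm_mult
      using real_distribution.cmod_char_le_1[OF real_dist_normal_dist] by (simp del: of_real_mult)
  qed (auto simp: char_std_normal_distribution)
  then show ?thesis
    by (simp add: char_average[OF assms(1) real_dist_normal_dist])
qed

text \<open>
  The squared modulus is the characteristic function of the symmetrization, which has no atom
  at \<open>0\<close>, so its Gaussian averages about each of the finitely many centres tend to \<open>0\<close>. Hence so does
  the average of the sum over all the shifts, and somewhere that sum is small.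
\<close>

lemma continuous_law_char_small_at_shifts:
  assumes "real_distribution M" and "\<And>x. measure M {x} = 0" and "finite B" and "\<epsilon> > 0"
  obtains r where "\<And>a. a \<in> B \<Longrightarrow> cmod (char M (r + a)) < \<epsilon>"
proof -
  let ?N = "std_normal_distribution"
  interpret M: real_distribution M by fact
  interpret N: real_distribution ?N by (rule real_dist_normal_dist)
  define R where "R = symmetrization M"
  have R: "real_distribution R" "measure R {0} = 0"
    unfolding R_def
    by (rule real_distribution_symmetrization[OF assms(1)],
        rule symmetrization_no_atom_at_zero[OF assms(1,2)])
  interpret R: real_distribution R by fact
  have charR: "char R t = complex_of_real ((cmod (char M t))\<^sup>2)" for t
    unfolding R_def by (rule char_symmetrization[OF assms(1)])
  have int: "integrable ?N (\<lambda>z. (cmod (char M (a + real n * z)))\<^sup>2)" for a n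
    using M.cmod_char_le_1 M.char_measurable
    by (intro N.integrable_const_bound[of _ 1]) (auto simp: power_le_one)
  have "(\<lambda>n. \<integral>z. (cmod (char M (a + real n * z)))\<^sup>2 \<partial>?N) \<longlonglongrightarrow> 0" for a
    using gaussian_average_char_tendsto_0[OF R, of a]
      tendsto_of_real_iff[where 'a = complex and c = 0 and F = sequentially]
    unfolding charR integral_complex_of_real of_real_0 by blast
  then have "(\<lambda>n. \<Sum>a\<in>B. \<integral>z. (cmod (char M (a + real n * z)))\<^sup>2 \<partial>?N) \<longlonglongrightarrow> (\<Sum>a\<in>B. 0)"
    by (intro tendsto_sum)
  then have "\<forall>\<^sub>F n in sequentially. (\<Sum>a\<in>B. \<integral>z. (cmod (char M (a + real n * z)))\<^sup>2 \<partial>?N) < \<epsilon>\<^sup>2"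
    by (rule order_tendstoD) (use assms in simp)
  then obtain n where "(\<Sum>a\<in>B. \<integral>z. (cmod (char M (a + real n * z)))\<^sup>2 \<partial>?N) < \<epsilon>\<^sup>2"
    by (meson eventually_happens trivial_limit_sequentially)
  then have n: "(\<integral>z. (\<Sum>a\<in>B. (cmod (char M (a + real n * z)))\<^sup>2) \<partial>?N) < \<epsilon>\<^sup>2"
    using int by simp
  have "\<exists>z. (\<Sum>a\<in>B. (cmod (char M (a + real n * z)))\<^sup>2) < \<epsilon>\<^sup>2"
  proof (rule ccontr)
    assume "\<not> ?thesis"
    then have "\<epsilon>\<^sup>2 \<le> (\<integral>z. (\<Sum>a\<in>B. (cmod (char M (a + real n * z)))\<^sup>2) \<partial>?N)"
      using int by (intro N.integral_ge_const) (auto simp: not_less)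
    with n show False by simp
  qed
  then obtain z where z: "(\<Sum>a\<in>B. (cmod (char M (a + real n * z)))\<^sup>2) < \<epsilon>\<^sup>2" by blast
  show ?thesis
  proof (rule that[of "real n * z"])
    fix a assume "a \<in> B"
    then have "(cmod (char M (a + real n * z)))\<^sup>2 \<le> (\<Sum>a\<in>B. (cmod (char M (a + real n * z)))\<^sup>2)"
      using assms(3) by (intro member_le_sum) auto
    with z have "(cmod (char M (a + real n * z)))\<^sup>2 < \<epsilon>\<^sup>2" by simp
    then show "cmod (char M (real n * z + a)) < \<epsilon>"
      using assms(4) by (simp add: add.commute power_less_imp_less_base less_imp_le)
  qed
qed

section \<open>Passing to the discrete part\<close>

text \<open>
  The mixture of the two laws is realized as a random choice between them by a biased coin; this
  makes it a probability measure whose distribution function is \<open>F\<close>.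
\<close>

lemma df_char_decomposition:
  fixes F G H :: "real \<Rightarrow> real" and c t :: real
  assumes "distribution_function F" "distribution_function G" "distribution_function H"
    and c: "0 \<le> c" "c \<le> 1" and F: "\<And>x. F x = c * G x + (1 - c) * H x"
  shows "df_char F t = complex_of_real c * df_char G t + complex_of_real (1 - c) * df_char H t"
proof -
  define K where "K b = interval_measure (if b then G else H)" for b
  let ?P = "measure_pmf (bernoulli_pmf c)"
  have rd: "real_distribution (K b)" for b
    unfolding K_def using assms(2,3) distribution_function_law(1) by (cases b) simp_all
  have K[measurable]: "K \<in> ?P \<rightarrow>\<^sub>M subprob_algebra borel"
    using rd by (auto simp: space_subprob_algebra real_distribution_def real_distribution_axioms_def
        prob_space_imp_subprob_space)
  define N where "N = ?P \<bind> K"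
  have prob: "prob_space (K b)" for b
    using rd by (simp add: real_distribution_def)
  have sets_N: "sets N = sets borel"
    unfolding N_def using rd by (intro sets_bind) (auto simp: real_distribution_def real_distribution_axioms_def)
  have int: "(\<integral>x. f x \<partial>N) = c * (\<integral>x. f x \<partial>interval_measure G) + (1 - c) * (\<integral>x. f x \<partial>interval_measure H)"
    if f: "f \<in> borel_measurable borel" "\<And>x. \<bar>f x\<bar> \<le> 1" for f :: "real \<Rightarrow> real"
  proof -
    have "(\<integral>x. f x \<partial>N) = (\<integral>b. \<integral>x. f x \<partial>K b \<partial>?P)"
      unfolding N_def
      by (rule integral_bind[where B = 1 and B' = 1 and K = borel])
        (use f K measure_pmf.finite_measure_axioms in
          \<open>auto simp: prob_space.emeasure_space_1[OF prob]\<close>)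
    then show ?thesis
      using c by (simp add: K_def mult.commute)
  qed
  have "prob_space N"
    unfolding N_def
    by (rule measure_pmf.prob_space_bind[where S = borel]) (use prob K in auto)
  then have N: "real_distribution N"
    using sets_N by (simp add: real_distribution_def real_distribution_axioms_def)
  have "cdf N x = F x" for x
  proof -
    have "(\<integral>y. indicator {..x} y \<partial>N) = c * (\<integral>y. indicator {..x} y \<partial>interval_measure G)
        + (1 - c) * (\<integral>y. indicator {..x} y \<partial>interval_measure H)"
      by (rule int) (auto simp: indicator_def)
    then have "cdf N x = c * cdf (interval_measure G) x + (1 - c) * cdf (interval_measure H) x"
      using sets_N by (simp add: cdf_def)
    then show ?thesis
      using assms(2,3) F by (simp add: distribution_function_law(2))
  qed
  then have "F = cdf N" by auto
  then have "interval_measure F = N"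
    using interval_measure_cdf[OF N] by simp
  then have F_N: "df_char F t = char N t"
    by (simp add: df_char_def)
  have re_im: "Re (char M t) = (\<integral>x. cos (t * x) \<partial>M)" "Im (char M t) = (\<integral>x. sin (t * x) \<partial>M)"
    if "real_distribution M" for M
  proof -
    interpret real_distribution M by fact
    show "Re (char M t) = (\<integral>x. cos (t * x) \<partial>M)" "Im (char M t) = (\<integral>x. sin (t * x) \<partial>M)"
      unfolding char_def using integral_Re[OF integrable_char_kernel[of t]] integral_Im[OF integrable_char_kernel[of t]]
      by (simp_all add: Re_exp Im_exp)
  qed
  show ?thesis
    unfolding F_N unfolding df_char_def
    by (rule complex_eqI)
      (simp_all add: re_im N distribution_function_law(1)[OF assms(2)] distribution_function_law(1)[OF assms(3)] int)
qed

text \<open>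
  Given \<open>\<epsilon> > 0\<close>, let \<open>S\<close> represent the translates of the discrete part up to \<open>\<epsilon>\<close>, and choose \<open>r\<close> so
  that the continuous part is small at \<open>r + (t - \<sigma>)\<close> and \<open>r + (t - \<sigma> + s)\<close> for all \<open>\<sigma> \<in> S\<close>
  at once. The \<open>\<sigma>\<close> that represents the translate by this \<open>r\<close> then makes \<open>v = r + (t - \<sigma>)\<close> a
  point where the discrete part looks as at \<open>t\<close> while the continuous part is negligible,
  and similarly for \<open>v + s\<close> and \<open>t + s\<close>. Since \<open>\<sigma>\<close> depends on \<open>r\<close>, smallness is needed at all
  of \<open>S\<close> beforehand.
\<close>

lemma discrete_part_char_shift:
  fixes F G H :: "real \<Rightarrow> real" and c s :: real
  assumes F: "\<And>t. df_char F t = complex_of_real c * df_char G t + complex_of_real (1 - c) * df_char H t"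
    and G: "discrete_df G" and H: "continuous_df H"
    and shift: "\<And>t. K * (cmod (df_char F t))\<^sup>2 \<le> cmod (df_char F (t + s))"
  shows "K * (cmod (c * df_char G t))\<^sup>2 \<le> cmod (c * df_char G (t + s))"
proof -
  obtain A where A: "countable A" "measure (interval_measure G) A = 1"
    using G unfolding discrete_df_def by blast
  have rdG: "real_distribution (interval_measure G)"
    using G by (simp add: discrete_df_def distribution_function_law(1))
  have dH: "distribution_function H"
    using H by (simp add: continuous_df_def)
  have rdH: "real_distribution (interval_measure H)"
    by (rule distribution_function_law(1)[OF dH])
  have no_atoms: "measure (interval_measure H) {x} = 0" for x
  proof -
    interpret real_distribution "interval_measure H" by fact
    have "isCont H x"
      using H by (simp add: continuous_df_def continuous_on_eq_continuous_at)
    then show ?thesis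
      using isCont_cdf[of x] by (simp add: distribution_function_law(2)[OF dH])
  qed
  have "\<exists>v. cmod (df_char G v - df_char G t) \<le> \<epsilon> \<and> cmod (df_char G (v + s) - df_char G (t + s)) \<le> \<epsilon>
      \<and> cmod (df_char H v) \<le> \<epsilon> \<and> cmod (df_char H (v + s)) \<le> \<epsilon>" if eps: "\<epsilon> > 0" for \<epsilon>
  proof -
    obtain S where S: "finite S"
      "\<And>r. \<exists>\<sigma>\<in>S. \<forall>u. cmod (df_char G (u + r) - df_char G (u + \<sigma>)) \<le> \<epsilon>"
      using char_translates_totally_bounded[OF rdG A eps] unfolding df_char_def by blast
    have "finite ((\<lambda>\<sigma>. t - \<sigma>) ` S \<union> (\<lambda>\<sigma>. t - \<sigma> + s) ` S)"
      using S(1) by simp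
    then obtain r where r: "\<And>a. a \<in> (\<lambda>\<sigma>. t - \<sigma>) ` S \<union> (\<lambda>\<sigma>. t - \<sigma> + s) ` S \<Longrightarrow> cmod (df_char H (r + a)) < \<epsilon>"
      using continuous_law_char_small_at_shifts[OF rdH no_atoms _ eps] unfolding df_char_def by metis
    obtain \<sigma> where \<sigma>: "\<sigma> \<in> S" "\<And>u. cmod (df_char G (u + r) - df_char G (u + \<sigma>)) \<le> \<epsilon>"
      using S(2) by blast
    have "cmod (df_char H (r + (t - \<sigma>))) < \<epsilon>" "cmod (df_char H (r + (t - \<sigma> + s))) < \<epsilon>"
      by (rule r; use \<sigma>(1) in blast)+
    with \<sigma>(2)[of "t - \<sigma>"] \<sigma>(2)[of "t - \<sigma> + s"] show ?thesis
      by (intro exI[of _ "r + (t - \<sigma>)"]) (simp add: algebra_simps)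
  qed
  then have "\<forall>n. \<exists>v. cmod (df_char G v - df_char G t) \<le> 1 / real (Suc n) \<and>
      cmod (df_char G (v + s) - df_char G (t + s)) \<le> 1 / real (Suc n) \<and>
      cmod (df_char H v) \<le> 1 / real (Suc n) \<and> cmod (df_char H (v + s)) \<le> 1 / real (Suc n)"
    by simp
  then obtain v where v: "\<And>n. cmod (df_char G (v n) - df_char G t) \<le> 1 / real (Suc n)"
      "\<And>n. cmod (df_char G (v n + s) - df_char G (t + s)) \<le> 1 / real (Suc n)"
      "\<And>n. cmod (df_char H (v n)) \<le> 1 / real (Suc n)" "\<And>n. cmod (df_char H (v n + s)) \<le> 1 / real (Suc n)"
    by metis
  have small: "X \<longlonglongrightarrow> 0" if "\<And>n. cmod (X n) \<le> 1 / real (Suc n)" for X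
    by (rule Lim_null_comparison[of _ "\<lambda>n. 1 / real (Suc n)"]) (use that LIMSEQ_Suc[OF lim_1_over_n] in simp_all)
  have G_lim: "(\<lambda>n. df_char G (v n)) \<longlonglongrightarrow> df_char G t" "(\<lambda>n. df_char G (v n + s)) \<longlonglongrightarrow> df_char G (t + s)"
    using small[OF v(1)] small[OF v(2)] by (simp_all add: LIM_zero_iff)
  have "(\<lambda>n. df_char F (v n)) \<longlonglongrightarrow> c * df_char G t + complex_of_real (1 - c) * 0"
    "(\<lambda>n. df_char F (v n + s)) \<longlonglongrightarrow> c * df_char G (t + s) + complex_of_real (1 - c) * 0"
    unfolding F by (intro tendsto_intros G_lim small v)+
  then have "(\<lambda>n. K * (cmod (df_char F (v n)))\<^sup>2) \<longlonglongrightarrow> K * (cmod (c * df_char G t))\<^sup>2"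
    "(\<lambda>n. cmod (df_char F (v n + s))) \<longlonglongrightarrow> cmod (c * df_char G (t + s))"
    by (auto intro!: tendsto_intros simp del: norm_mult)
  then show ?thesis
    by (rule LIMSEQ_le) (use shift in blast)
qed

section \<open>The lower bound for the discrete part\<close>

theorem theorem2:
  fixes F F\<^sub>d F\<^sub>c :: "real \<Rightarrow> real" and c\<^sub>d :: real
  assumes "rational_infinitely_divisible F"
    and "discrete_continuous_decomposition F c\<^sub>d F\<^sub>d F\<^sub>c"
    and "c\<^sub>d > 0"
  shows "(INF t. norm (df_char F\<^sub>d t)) > 0"
proof -
  have dec: "0 \<le> c\<^sub>d" "c\<^sub>d \<le> 1" "discrete_df F\<^sub>d" "continuous_df F\<^sub>c"
      "\<And>x. F x = c\<^sub>d * F\<^sub>d x + (1 - c\<^sub>d) * F\<^sub>c x"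
    using assms(2) by (auto simp: discrete_continuous_decomposition_def)
  have dfs: "distribution_function F" "distribution_function F\<^sub>d" "distribution_function F\<^sub>c"
    using assms(1) dec by (simp_all add: rational_infinitely_divisible_def discrete_df_def continuous_df_def)
  let ?f = "df_char F\<^sub>d"
  obtain K :: "real \<Rightarrow> real" where K: "\<And>s. K s > 0"
    "\<And>s t. K s * (cmod (df_char F t))\<^sup>2 \<le> cmod (df_char F (t + s))"
    using rational_infinitely_divisible_char_shift[OF assms(1)] by blast
  have shift: "K s * (cmod (c\<^sub>d * ?f t))\<^sup>2 \<le> cmod (c\<^sub>d * ?f (t + s))" for s t
    by (rule discrete_part_char_shift[OF df_char_decomposition[OF dfs dec(1,2,5)] dec(3,4) K(2)])
  have rd: "real_distribution (interval_measure F\<^sub>d)"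
    by (rule distribution_function_law(1)[OF dfs(2)])
  obtain A where "countable A" "measure (interval_measure F\<^sub>d) A = 1"
    using dec(3) unfolding discrete_df_def by blast
  then obtain S where S: "finite S"
    "\<And>t. \<exists>\<sigma>\<in>S. \<forall>u. cmod (?f (u + t) - ?f (u + \<sigma>)) \<le> 1 / 2"
    using char_translates_totally_bounded[OF rd, of A "1 / 2"] unfolding df_char_def by auto
  have "S \<noteq> {}" using S(2) by blast
  define m where "m = Min ((\<lambda>\<sigma>. K \<sigma> * c\<^sub>d / 4) ` S)"
  have "m > 0"
    unfolding m_def using S(1) \<open>S \<noteq> {}\<close> K(1) assms(3) by simp
  have "m \<le> cmod (?f t)" for t
  proof -
    obtain \<sigma> where \<sigma>: "\<sigma> \<in> S" "cmod (?f (- \<sigma> + t) - ?f (- \<sigma> + \<sigma>)) \<le> 1 / 2"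
      using S(2) by blast
    have "?f 0 = 1"
      unfolding df_char_def by (rule real_distribution.char_zero[OF rd])
    then have "cmod (?f (t - \<sigma>)) \<ge> 1 / 2"
      using \<sigma>(2) norm_triangle_ineq2[of 1 "1 - ?f (t - \<sigma>)"] by (simp add: norm_minus_commute)
    then have "(1 / 2)\<^sup>2 \<le> (cmod (?f (t - \<sigma>)))\<^sup>2"
      by (rule power_mono) simp
    then have "K \<sigma> * c\<^sub>d\<^sup>2 * (1 / 2)\<^sup>2 \<le> K \<sigma> * c\<^sub>d\<^sup>2 * (cmod (?f (t - \<sigma>)))\<^sup>2"
      using K(1)[of \<sigma>] by (intro mult_left_mono) auto
    also have "\<dots> \<le> c\<^sub>d * cmod (?f t)"
      using shift[of \<sigma> "t - \<sigma>"] dec(1) by (simp add: norm_mult power_mult_distrib mult.assoc)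
    finally have "c\<^sub>d * (K \<sigma> * c\<^sub>d / 4) \<le> c\<^sub>d * cmod (?f t)"
      by (simp add: power2_eq_square mult_ac)
    then have "K \<sigma> * c\<^sub>d / 4 \<le> cmod (?f t)"
      using assms(3) by (simp only: mult_le_cancel_left_pos)
    moreover have "m \<le> K \<sigma> * c\<^sub>d / 4"
      unfolding m_def by (rule Min_le) (use S(1) \<sigma>(1) in auto)
    ultimately show ?thesis by simp
  qed
  then have "m \<le> (INF t. norm (?f t))"
    by (intro cINF_greatest) auto
  with \<open>m > 0\<close> show ?thesis by simp
qed

end
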